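(* Let $p_1=2, p_2=3, p_3=5,\dots$ denote the primes in increasing order. For $k\ge 2$ let $$T^{TP}_k=\frac{\prod_{i=2}^{k-1}(p_i-2)}{\prod_{i=2}^{k}p_i}=\frac{1\cdot 3\cdot 5\cdots (p_{k-1}-2)}{3\cdot 5\cdot 7\cdots p_k}$$ (the empty product equals $1$; so $T^{TP}_2=\tfrac13, T^{TP}_3=\tfrac1{15}, T^{TP}_4=\tfrac{3}{105}, T^{TP}_5=\tfrac{15}{1155},\dots$), and for $n\ge 2$ let $S^{TP}_n=\sum_{k=2}^n T^{TP}_k$. Then $$\lim_{n\to\infty}S^{TP}_n=\frac12.$$ *)

theory Defs
  imports
    Complex_Main
    "HOL-Library.Infinite_Set"
    "HOL-Computational_Algebra.Primes"
begin

text \<open>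
  The primes in increasing order, indexed from 1 (so the first is 2, the second 3, and so on).
  Since \<^const>\<open>enumerate\<close> counts from 0, index 0 is a junk value (also 2) and never used below.
\<close>
definition nth_prime :: "nat \<Rightarrow> nat" where
  "nth_prime i = enumerate {p. prime p} (i - 1)"

text \<open>The following two are meaningful for indices \<open>\<ge> 2\<close> only.\<close>

definition T_TP :: "nat \<Rightarrow> real" where
  "T_TP k = (\<Prod>i=2..k-1. real (nth_prime i) - 2) / (\<Prod>i=2..k. real (nth_prime i))"

definition S_TP :: "nat \<Rightarrow> real" where
  "S_TP n = (\<Sum>k=2..n. T_TP k)"

end

theory Submission
  imports Defs "HOL-Analysis.Harmonic_Numbers"
begin

text \<open>
  With \<open>P n = (\<Prod>i=2..n. 1 - 2 / p\<^sub>i)\<close> one has \<open>2 * T k = P (k - 1) - P k\<close>, so the sum telescopes to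
  \<open>(1 - P n) / 2\<close>. It remains to see \<open>P n \<longlonglongrightarrow> 0\<close>. Here \<open>1 - 2 / p \<le> 1 - 1 / p\<close>, and by Euler's
  argument \<open>\<Prod>p\<in>A. 1 - 1 / p\<close> times the sum of reciprocals of \<open>A\<close>-smooth numbers is at most 1, while
  the latter sum dominates a harmonic number.
\<close>

text \<open>The cut-off \<open>N\<close> makes every sum of reciprocals finite, so Euler's argument
  needs no infinite series.\<close>

definition smooth_upto :: "nat set \<Rightarrow> nat \<Rightarrow> nat set" where
  "smooth_upto A N = {n \<in> {1..N}. \<forall>q. prime q \<longrightarrow> q dvd n \<longrightarrow> q \<in> A}"

lemma finite_smooth_upto: "finite (smooth_upto A N)"
  by (simp add: smooth_upto_def)

lemma smooth_upto_empty: "smooth_upto {} N \<subseteq> {1}"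
  unfolding smooth_upto_def using prime_factor_nat by blast

text \<open>Only one factor \<open>p\<close> is split off, and the quotient may still be divisible
  by \<open>p\<close>; hence \<open>insert p A\<close> recurs on the right. This self-reference
  replaces the geometric series in 1/p.\<close>

lemma smooth_upto_insert:
  assumes "prime p"
  shows "smooth_upto (insert p A) N \<subseteq> smooth_upto A N \<union> (*) p ` smooth_upto (insert p A) N"
proof
  fix n assume n: "n \<in> smooth_upto (insert p A) N"
  show "n \<in> smooth_upto A N \<union> (*) p ` smooth_upto (insert p A) N"
  proof (cases "p dvd n")
    case True
    then obtain m where m: "n = p * m" by blast
    with n have "m > 0" by (auto simp: smooth_upto_def intro!: Nat.gr0I)
    moreover have "m \<le> N"
      using m n prime_gt_0_nat[OF assms] le_trans[of m n N] by (simp add: smooth_upto_def)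
    ultimately have "m \<in> smooth_upto (insert p A) N"
      using n m by (auto simp: smooth_upto_def)
    then show ?thesis using m by blast
  next
    case False
    then show ?thesis using n by (auto simp: smooth_upto_def)
  qed
qed

text \<open>Adding a prime \<open>p\<close> turns the inclusion above into S \<le> S_A + S/p for the
  reciprocal sums, that is (1 - 1/p) S \<le> S_A, so the new factor is absorbed.\<close>

lemma euler_product_smooth_le_1:
  assumes "finite A" "\<And>p. p \<in> A \<Longrightarrow> prime p"
  shows "(\<Prod>p\<in>A. 1 - 1 / real p) * (\<Sum>n\<in>smooth_upto A N. 1 / real n) \<le> 1"
  using assms
proof (induction A rule: finite_induct)
  case empty
  have "(\<Sum>n\<in>smooth_upto {} N. 1 / real n) \<le> (\<Sum>n\<in>{1}. 1 / real n)"
    by (rule sum_mono2) (use smooth_upto_empty in auto)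
  then show ?case by simp
next
  case (insert p A)
  let ?f = "\<lambda>n. 1 / real n" and ?S = "smooth_upto (insert p A) N"
  have p: "prime p" using insert.prems by simp
  have "sum ?f ?S \<le> sum ?f (smooth_upto A N \<union> (*) p ` ?S)"
    by (rule sum_mono2) (use smooth_upto_insert[OF p] in \<open>auto simp: finite_smooth_upto\<close>)
  also have "\<dots> \<le> sum ?f (smooth_upto A N) + sum ?f ((*) p ` ?S)"
    by (simp add: sum_Un finite_smooth_upto sum_nonneg)
  also have "sum ?f ((*) p ` ?S) = 1 / real p * sum ?f ?S"
    using prime_gt_0_nat[OF p] by (subst sum.reindex) (auto simp: inj_on_def sum_distrib_left)
  finally have "(1 - 1 / real p) * sum ?f ?S \<le> sum ?f (smooth_upto A N)"
    by (simp add: algebra_simps)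
  moreover have "0 \<le> (\<Prod>p\<in>A. 1 - 1 / real p)"
    using insert.prems by (intro prod_nonneg) (auto simp: divide_le_eq_1 dest: prime_ge_1_nat)
  ultimately have "(\<Prod>p\<in>A. 1 - 1 / real p) * ((1 - 1 / real p) * sum ?f ?S)
      \<le> (\<Prod>p\<in>A. 1 - 1 / real p) * sum ?f (smooth_upto A N)"
    by (rule mult_left_mono)
  also have "\<dots> \<le> 1" using insert by simp
  finally show ?case using insert.hyps by (simp add: ac_simps)
qed

lemma prime_nth_prime: "prime (nth_prime i)"
  using enumerate_in_set[OF primes_infinite] by (simp add: nth_prime_def)

text \<open>Index 0 must stay out: by truncated subtraction it yields 2, just as index 1
  does.\<close>

lemma inj_on_nth_prime: "inj_on nth_prime {1..n}"
  using strict_mono_enumerate[OF primes_infinite]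
  by (auto simp: inj_on_def nth_prime_def strict_mono_eq)

lemma nth_prime_1: "nth_prime 1 = 2"
  by (auto simp: nth_prime_def enumerate_0 intro!: Least_equality dest: prime_ge_2_nat)

lemma nth_prime_ge_3:
  assumes "i \<ge> 2"
  shows "nth_prime i \<ge> 3"
proof -
  have "nth_prime 1 < nth_prime i"
    using assms unfolding nth_prime_def by (intro enumerate_mono primes_infinite) simp
  then show ?thesis by (simp add: nth_prime_1[simplified])
qed

lemma prime_le_imp_in_nth_prime_image:
  assumes "prime q" "q \<le> n"
  shows "q \<in> nth_prime ` {1..n}"
proof -
  obtain j where j: "enumerate {p. prime p} j = q"
    using enumerate_Ex[OF primes_infinite, of q] assms by auto
  \<comment> \<open>A strictly increasing sequence of naturals starting at 2 outgrows its 1-based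
    index, so a prime up to \<open>n\<close> has index at most \<open>n\<close>.\<close>
  have "j \<le> enumerate {p. prime p} (j - 1)" if "j \<ge> 1" for j
    using that
  proof (induction j rule: dec_induct)
    case base
    then show ?case using nth_prime_1 by (simp add: nth_prime_def)
  next
    case (step k)
    then show ?case using enumerate_step[OF primes_infinite, of "k - 1"] by simp
  qed
  from this[of "Suc j"] j have "j < q" by simp
  then show ?thesis
    using j assms by (intro image_eqI[of _ _ "Suc j"]) (auto simp: nth_prime_def)
qed

text \<open>Prime factors of a number up to \<open>n\<close> are among the first \<open>n\<close>
  primes. Taking that many primes is generous, but it avoids counting primes and lets one
  \<open>n\<close> serve as index bound and cut-off.\<close>

lemma prod_nth_prime_harm_le_1:
  "(\<Prod>i=1..n. 1 - 1 / real (nth_prime i)) * harm n \<le> 1"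
proof -
  let ?A = "nth_prime ` {1..n}"
  have "q \<in> ?A" if "k \<in> {1..n}" "prime q" "q dvd k" for k q
    using that dvd_imp_le[of q k] by (intro prime_le_imp_in_nth_prime_image) auto
  then have "smooth_upto ?A n = {1..n}"
    unfolding smooth_upto_def by blast
  then have "(\<Prod>p\<in>?A. 1 - 1 / real p) * harm n \<le> 1"
    using euler_product_smooth_le_1[of ?A n, OF finite_imageI] prime_nth_prime
    by (force simp: harm_def inverse_eq_divide)
  then show ?thesis unfolding prod.reindex[OF inj_on_nth_prime] o_def .
qed

lemma prod_one_minus_two_div_nth_prime_tendsto_0:
  "(\<lambda>n. \<Prod>i=2..n. 1 - 2 / real (nth_prime i)) \<longlonglongrightarrow> 0"
proof (rule tendsto_sandwich)
  have bounds: "0 \<le> 1 - 2 / real (nth_prime i)"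
    "1 - 2 / real (nth_prime i) \<le> 1 - 1 / real (nth_prime i)" if "i \<ge> 2" for i
    using nth_prime_ge_3[OF that] by (simp_all add: divide_right_mono)
  show "\<forall>\<^sub>F n in sequentially. 0 \<le> (\<Prod>i=2..n. 1 - 2 / real (nth_prime i))"
    by (intro always_eventually allI prod_nonneg bounds) simp
  have "(\<Prod>i=2..n. 1 - 2 / real (nth_prime i)) \<le> 2 / harm n" if "n \<ge> 1" for n
  proof -
    have "(\<Prod>i=2..n. 1 - 2 / real (nth_prime i)) \<le> (\<Prod>i=2..n. 1 - 1 / real (nth_prime i))"
      by (intro prod_mono conjI bounds) simp_all
    \<comment> \<open>The factor restored at index 1 belongs to the prime 2 and equals 1/2.\<close>
    also have "\<dots> = 2 * (\<Prod>i=1..n. 1 - 1 / real (nth_prime i))"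
      using prod.atLeast_Suc_atMost[OF that, of "\<lambda>i. 1 - 1 / real (nth_prime i)"]
      by (simp add: nth_prime_1[simplified] numeral_2_eq_2)
    also have "\<dots> \<le> 2 * (1 / harm n)"
      using prod_nth_prime_harm_le_1[of n] harm_pos[of n, where 'a=real] that
      by (simp add: field_simps)
    finally show ?thesis by simp
  qed
  then show "\<forall>\<^sub>F n in sequentially. (\<Prod>i=2..n. 1 - 2 / real (nth_prime i)) \<le> 2 / harm n"
    using eventually_ge_at_top[of 1] by (rule eventually_mono[rotated])
  show "(\<lambda>n. 2 / harm n :: real) \<longlonglongrightarrow> 0"
    by (rule real_tendsto_divide_at_top[OF tendsto_const harm_at_top])
qed simp

lemma T_TP_Suc:
  assumes "n \<ge> 1"
  shows "T_TP (Suc n) = (\<Prod>i=2..n. 1 - 2 / real (nth_prime i)) / real (nth_prime (Suc n))"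
proof -
  have "real (nth_prime i) \<noteq> 0" for i
    using prime_gt_0_nat[OF prime_nth_prime[of i]] by simp
  then have "(\<Prod>i=2..n. 1 - 2 / real (nth_prime i))
      = (\<Prod>i=2..n. real (nth_prime i) - 2) / (\<Prod>i=2..n. real (nth_prime i))"
    unfolding prod_dividef[symmetric] by (intro prod.cong) (auto simp: diff_divide_distrib)
  then show ?thesis using assms by (simp add: T_TP_def)
qed

lemma S_TP_eq:
  assumes "n \<ge> 1"
  shows "S_TP n = (1 - (\<Prod>i=2..n. 1 - 2 / real (nth_prime i))) / 2"
  using assms
proof (induction n rule: dec_induct)
  \<comment> \<open>Starting at 1 makes both the sum and the product empty, so the claim reads 0 =
    (1 - 1) / 2.\<close>
  case base
  then show ?case by (simp add: S_TP_def)
next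
  case (step n)
  then have "S_TP (Suc n) = S_TP n + T_TP (Suc n)" by (simp add: S_TP_def)
  then show ?case using step by (simp add: T_TP_Suc field_simps)
qed

theorem theorem3:
  shows "S_TP \<longlonglongrightarrow> 1 / 2"
proof -
  have "(\<lambda>n. (1 - (\<Prod>i=2..n. 1 - 2 / real (nth_prime i))) / 2) \<longlonglongrightarrow> (1 - 0) / 2"
    by (intro tendsto_intros prod_one_minus_two_div_nth_prime_tendsto_0) simp
  moreover have "\<forall>\<^sub>F n in sequentially.
      (1 - (\<Prod>i=2..n. 1 - 2 / real (nth_prime i))) / 2 = S_TP n"
    using eventually_ge_at_top[of 1] by eventually_elim (simp add: S_TP_eq)
  ultimately show ?thesis by (simp add: Lim_transform_eventually)
qed

end
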